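(* Let $n\ge 2$. For every $A\in\mathcal{A}$ and every $M\in\mathcal{M}_P$ one has $AMA^\top\in\mathcal{M}_P$. Moreover, for every $A\in\mathcal{A}$, $$A\,\mathcal{M}_P\,A^\top=\{AMA^\top \mid M\in\mathcal{M}_P\}=\mathcal{M}_P .$$ That is, the group $\mathcal{A}$ acts on $\mathcal{M}_P$ by $M\mapsto AMA^\top$.
   Context: Let $f_P(x)=(1,x,x^2,\ldots,x^{n-1})^\top$ for $x\in\mathbb{R}$. The moment cone $\mathcal{M}_P$ is the set of all positive definite $n\times n$ matrices of the form $\int_{\mathbb{R}} f_P(x)f_P(x)^\top\,d\rho(x)$, where $\rho$ is a nonnegative finite measure on $\mathbb{R}$ for which the integral exists. For real $a,b,c,d$ with $ad-bc\neq0$, $A(a,b,c,d)$ is the $n\times n$ matrix determined by $(cx+d)^{n-1}f_P\!\left(\frac{ax+b}{cx+d}\right)=A(a,b,c,d)f_P(x)$; i.e. the $i$-th entry of $A(a,b,c,d)f_P(x)$ is the polynomial $(ax+b)^{i-1}(cx+d)^{n-i}$. The set $\mathcal{A}=\{A(a,b,c,d)\mid a,b,c,d\in\mathbb{R},\ ad-bc\ne0\}$ is a group under matrix multiplication. *)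

theory Defs
  imports
    "HOL-Analysis.Bochner_Integration"
    "HOL-Computational_Algebra.Polynomial"
    "HOL-Algebra.Group_Action"
    "Jordan_Normal_Form.Matrix"
begin

text \<open>Matrix and vector indices run from 0 to \<open>n - 1\<close>, so all exponents are shifted by one
  with respect to a 1-based presentation.\<close>

definition f_P :: "nat \<Rightarrow> real \<Rightarrow> real Matrix.vec" where
  "f_P n x = Matrix.vec n (\<lambda>i. x ^ i)"

definition outer_prod :: "real Matrix.vec \<Rightarrow> real Matrix.vec \<Rightarrow> real mat" where
  "outer_prod u v = Matrix.mat (dim_vec u) (dim_vec v) (\<lambda>(i, j). vec_index u i * vec_index v j)"

definition positive_definite :: "nat \<Rightarrow> real mat \<Rightarrow> bool" where
  "positive_definite n M \<longleftrightarrow> M \<in> carrier_mat n n \<and> transpose_mat M = M \<and>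
     (\<forall>v \<in> carrier_vec n. v \<noteq> 0\<^sub>v n \<longrightarrow> scalar_prod v (M *\<^sub>v v) > 0)"

text \<open>Integrals of matrix-valued functions are taken entrywise. The Bochner integral of a
  non-integrable function is 0 by convention, so existence of the integral is kept as a separate
  condition.\<close>

definition mat_integrable :: "nat \<Rightarrow> real measure \<Rightarrow> (real \<Rightarrow> real mat) \<Rightarrow> bool" where
  "mat_integrable n \<rho> F \<longleftrightarrow> (\<forall>i<n. \<forall>j<n. integrable \<rho> (\<lambda>x. F x $$ (i, j)))"

definition mat_integral :: "nat \<Rightarrow> real measure \<Rightarrow> (real \<Rightarrow> real mat) \<Rightarrow> real mat" where
  "mat_integral n \<rho> F = Matrix.mat n n (\<lambda>(i, j). integral\<^sup>L \<rho> (\<lambda>x. F x $$ (i, j)))"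

definition moment_cone :: "nat \<Rightarrow> real mat set" where
  "moment_cone n = {M. positive_definite n M \<and>
     (\<exists>\<rho> :: real measure. sets \<rho> = sets borel \<and> finite_measure \<rho> \<and>
        mat_integrable n \<rho> (\<lambda>x. outer_prod (f_P n x) (f_P n x)) \<and>
        M = mat_integral n \<rho> (\<lambda>x. outer_prod (f_P n x) (f_P n x)))}"

text \<open>Row \<open>i\<close> lists the coefficients of the polynomial \<open>(a x + b)\<^sup>i (c x + d)\<^bsup>n - 1 - i\<^esup>\<close>.
  Lemmas \<open>moebius_mat_transforms_f_P\<close> and \<open>moebius_mat_unique\<close> below show that this is the
  matrix determined by the transformation rule for \<open>f_P\<close>.\<close>

definition moebius_mat :: "nat \<Rightarrow> real \<Rightarrow> real \<Rightarrow> real \<Rightarrow> real \<Rightarrow> real mat" where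
  "moebius_mat n a b c d =
     Matrix.mat n n (\<lambda>(i, j). coeff ([:b, a:] ^ i * [:d, c:] ^ (n - 1 - i)) j)"

lemma mult_mat_vec_f_P:
  assumes "B \<in> carrier_mat n n" "i < n"
  shows "vec_index (B *\<^sub>v f_P n x) i = (\<Sum>j<n. B $$ (i, j) * x ^ j)"
  using assms by (auto simp: f_P_def scalar_prod_def atLeast0LessThan intro!: sum.cong)

lemma moebius_mat_mult_f_P:
  "moebius_mat n a b c d *\<^sub>v f_P n x =
     Matrix.vec n (\<lambda>i. (a * x + b) ^ i * (c * x + d) ^ (n - 1 - i))"
proof (rule eq_vecI)
  fix i assume "i < dim_vec (Matrix.vec n (\<lambda>i. (a * x + b) ^ i * (c * x + d) ^ (n - 1 - i)))"
  then have i: "i < n" by simp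
  let ?p = "[:b, a:] ^ i * [:d, c:] ^ (n - 1 - i)"
  have "degree ?p \<le> degree ([:b, a:] ^ i) + degree ([:d, c:] ^ (n - 1 - i))"
    by (rule degree_mult_le)
  also have "\<dots> \<le> 1 * i + 1 * (n - 1 - i)"
    by (intro add_mono order_trans[OF degree_power_le] mult_right_mono) auto
  finally have deg: "degree ?p < n" using i by simp
  have "vec_index (moebius_mat n a b c d *\<^sub>v f_P n x) i = (\<Sum>j<n. coeff ?p j * x ^ j)"
    using i by (subst mult_mat_vec_f_P) (auto simp: moebius_mat_def)
  also have "\<dots> = (\<Sum>j\<le>degree ?p. coeff ?p j * x ^ j)"
    using deg by (intro sum.mono_neutral_right) (auto simp: coeff_eq_0)
  also have "\<dots> = (a * x + b) ^ i * (c * x + d) ^ (n - 1 - i)"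
    unfolding poly_altdef[symmetric] by (simp add: algebra_simps)
  finally show "vec_index (moebius_mat n a b c d *\<^sub>v f_P n x) i =
      vec_index (Matrix.vec n (\<lambda>i. (a * x + b) ^ i * (c * x + d) ^ (n - 1 - i))) i"
    using i by simp
qed (simp add: moebius_mat_def)

lemma moebius_mat_transforms_f_P:
  assumes "c * x + d \<noteq> 0"
  shows "(c * x + d) ^ (n - 1) \<cdot>\<^sub>v f_P n ((a * x + b) / (c * x + d)) =
    moebius_mat n a b c d *\<^sub>v f_P n x"
proof (rule eq_vecI)
  fix i assume "i < dim_vec (moebius_mat n a b c d *\<^sub>v f_P n x)"
  then have i: "i < n" by (simp add: moebius_mat_def)
  then have "(c * x + d) ^ (n - 1) = (c * x + d) ^ i * (c * x + d) ^ (n - 1 - i)"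
    by (simp flip: power_add)
  with i assms show "vec_index ((c * x + d) ^ (n - 1) \<cdot>\<^sub>v f_P n ((a * x + b) / (c * x + d))) i =
      vec_index (moebius_mat n a b c d *\<^sub>v f_P n x) i"
    unfolding moebius_mat_mult_f_P by (simp add: f_P_def power_divide)
qed (simp add: f_P_def moebius_mat_def)

lemma moebius_mat_unique:
  assumes B: "B \<in> carrier_mat n n" and det: "a * d - b * c \<noteq> 0"
    and eq: "\<And>x. c * x + d \<noteq> 0 \<Longrightarrow>
      (c * x + d) ^ (n - 1) \<cdot>\<^sub>v f_P n ((a * x + b) / (c * x + d)) = B *\<^sub>v f_P n x"
  shows "B = moebius_mat n a b c d"
proof (rule eq_matI)
  let ?A = "moebius_mat n a b c d"
  have A: "?A \<in> carrier_mat n n" by (simp add: moebius_mat_def)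
  fix i j assume "i < dim_row ?A" "j < dim_col ?A"
  then have i: "i < n" and j: "j < n" by (auto simp: moebius_mat_def)
  define p where "p = (\<Sum>k<n. monom (B $$ (i, k) - ?A $$ (i, k)) k)"
  have "poly p x = 0" if "c * x + d \<noteq> 0" for x
  proof -
    have "B *\<^sub>v f_P n x = ?A *\<^sub>v f_P n x"
      using eq[OF that] moebius_mat_transforms_f_P[OF that] by simp
    then have "vec_index (B *\<^sub>v f_P n x) i = vec_index (?A *\<^sub>v f_P n x) i" by simp
    then show ?thesis
      unfolding mult_mat_vec_f_P[OF A i] mult_mat_vec_f_P[OF B i]
      by (simp add: p_def poly_sum poly_monom left_diff_distrib sum_subtractf)
  qed
  then have sub: "UNIV \<subseteq> {x. poly p x = 0} \<union> {x. poly [:d, c:] x = 0}"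
    by (auto simp: algebra_simps)
  have "[:d, c:] \<noteq> 0" using det by auto
  then have "finite {x. poly [:d, c:] x = 0}" by (rule poly_roots_finite)
  then have "infinite {x. poly p x = 0}"
    using sub finite_subset infinite_UNIV_char_0[where 'a = real] by blast
  then have "p = 0" using poly_roots_finite by blast
  then have "coeff p j = 0" by simp
  with j show "B $$ (i, j) = ?A $$ (i, j)"
    by (simp add: p_def coeff_sum if_distrib sum.delta cong: if_cong)
qed (use B in \<open>auto simp: moebius_mat_def\<close>)

definition moebius_mats :: "nat \<Rightarrow> real mat set" where
  "moebius_mats n = {moebius_mat n a b c d | a b c d. a * d - b * c \<noteq> 0}"

definition moebius_group :: "nat \<Rightarrow> real mat monoid" where
  "moebius_group n = \<lparr>carrier = moebius_mats n, monoid.mult = (*), one = 1\<^sub>m n\<rparr>"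

end

theory Submission
  imports Defs "Jordan_Normal_Form.Determinant"
    "HOL-Computational_Algebra.Fundamental_Theorem_Algebra"
begin

text \<open>Pushing a representing measure forward along \<open>x \<mapsto> (a x + b) / (c x + d)\<close> fails if it has an
  atom at the pole, since that atom is sent to infinity. Instead, the moment cone is identified with
  the positive definite Hankel matrices: a positive definite Hankel matrix defines a linear
  functional that is positive on squares, its orthogonal polynomial of degree \<open>n\<close> has \<open>n\<close> distinct
  real roots, and Gauss quadrature at these roots represents the matrix by a finitely supported
  measure. Congruence by an invertible matrix preserves positive definiteness, and congruence by a
  Moebius matrix preserves the Hankel structure because the product of the polynomials in rows
  \<open>i\<close> and \<open>j\<close> depends on \<open>i + j\<close> only.\<close>

section \<open>The linear functional of a moment sequence\<close>

text \<open>The Riesz functional of \<open>m\<close>: the linear extension of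
  \<open>x ^ k \<mapsto> m k\<close>, which is integration whenever \<open>m\<close> is the moment
  sequence of a measure.\<close>

definition moment_functional :: "(nat \<Rightarrow> real) \<Rightarrow> real poly \<Rightarrow> real" where
  "moment_functional m p = (\<Sum>k\<le>degree p. coeff p k * m k)"

text \<open>Padding with zero coefficients gives polynomials of different degrees a common summation
  range; the degree of a sum may drop, so additivity relies on this.\<close>

lemma moment_functional_altdef:
  assumes "degree p \<le> N"
  shows "moment_functional m p = (\<Sum>k\<le>N. coeff p k * m k)"
  unfolding moment_functional_def using assms
  by (intro sum.mono_neutral_left) (auto simp: coeff_eq_0)

lemma moment_functional_0 [simp]: "moment_functional m 0 = 0"
  by (simp add: moment_functional_def)

lemma moment_functional_add:
  "moment_functional m (p + q) = moment_functional m p + moment_functional m q"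
proof -
  define N where "N = max (degree p) (degree q)"
  have "degree p \<le> N" "degree q \<le> N" "degree (p + q) \<le> N"
    by (auto simp: N_def degree_add_le_max)
  then show ?thesis
    by (simp add: moment_functional_altdef[where N = N] sum.distrib algebra_simps)
qed

lemma moment_functional_smult:
  "moment_functional m (Polynomial.smult c p) = c * moment_functional m p"
  by (subst moment_functional_altdef[where N = "degree p"])
    (auto simp: degree_smult_le moment_functional_def sum_distrib_left algebra_simps)

lemma moment_functional_sum:
  "moment_functional m (sum f A) = (\<Sum>a\<in>A. moment_functional m (f a))"
  by (induction A rule: infinite_finite_induct) (auto simp: moment_functional_add)

lemma moment_functional_monom: "moment_functional m (monom c k) = c * m k"
  by (subst moment_functional_altdef[where N = k])
    (auto simp: degree_monom_le if_distrib if_distribR sum.delta cong: if_cong)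

lemma poly_eq_sum_monoms_lessThan:
  assumes "degree p < n"
  shows "p = (\<Sum>i<n. monom (coeff p i) i)"
proof -
  have "{..<n} = {..n - 1}" using assms by auto
  then show ?thesis using poly_as_sum_of_monoms'[of p "n - 1"] assms by simp
qed

text \<open>The right-hand side is the bilinear form of the Hankel matrix of \<open>m\<close> at the
  two coefficient vectors. This is the bridge between matrices and polynomials.\<close>

lemma moment_functional_mult:
  assumes "degree p < n" "degree q < n"
  shows "moment_functional m (p * q) = (\<Sum>i<n. \<Sum>j<n. coeff p i * coeff q j * m (i + j))"
proof -
  have "p * q = (\<Sum>i<n. monom (coeff p i) i) * (\<Sum>j<n. monom (coeff q j) j)"
    using assms by (metis poly_eq_sum_monoms_lessThan)
  also have "\<dots> = (\<Sum>i<n. \<Sum>j<n. monom (coeff p i * coeff q j) (i + j))"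
    by (simp add: sum_product mult_monom)
  finally show ?thesis by (simp add: moment_functional_sum moment_functional_monom)
qed

section \<open>Real-rootedness\<close>

lemma map_poly_of_real_add:
  "map_poly of_real (p + q) = (map_poly of_real p + map_poly of_real q :: complex poly)"
  by (rule poly_eqI) (simp add: coeff_map_poly)

lemma map_poly_of_real_mult:
  "map_poly of_real (p * q) = (map_poly of_real p * map_poly of_real q :: complex poly)"
  by (rule poly_eqI) (simp add: coeff_map_poly coeff_mult)

lemma poly_map_poly_of_real:
  "poly (map_poly of_real p) (of_real x) = (of_real (poly p x) :: complex)"
  by (induction p) (auto simp: map_poly_pCons)

text \<open>The divisor is the minimal polynomial of \<open>z\<close> over the reals. The remainder
  \<open>u + v * x\<close> of \<open>p\<close> vanishes at \<open>z\<close>; its imaginary part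
  there is \<open>v * Im z\<close>, so \<open>v = 0\<close> and then \<open>u = 0\<close>.\<close>

lemma quadratic_dvd_of_nonreal_root:
  fixes p :: "real poly"
  assumes root: "poly (map_poly complex_of_real p) z = 0" and Im: "Im z \<noteq> 0"
  shows "[:(Re z)\<^sup>2 + (Im z)\<^sup>2, - 2 * Re z, 1:] dvd p"
proof -
  define q where "q = [:(Re z)\<^sup>2 + (Im z)\<^sup>2, - 2 * Re z, 1:]"
  define r where "r = p mod q"
  have q0: "q \<noteq> 0" by (simp add: q_def)
  have "degree r < 2"
    using degree_mod_less[OF q0, of p] by (auto simp: r_def q_def)
  then have "degree r \<le> 1" by simp
  then obtain u v where r: "r = [:u, v:]"
    by (metis degree1_coeffs degree_eq_zeroE le_neq_implies_less less_one pCons_0_0)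
  have hq: "poly (map_poly complex_of_real q) z = 0"
    by (simp add: q_def map_poly_pCons complex_eq_iff power2_eq_square algebra_simps)
  have "p = q * (p div q) + r" by (simp add: r_def)
  then have "map_poly complex_of_real p =
      map_poly complex_of_real q * map_poly complex_of_real (p div q) + map_poly complex_of_real r"
    by (metis map_poly_of_real_add map_poly_of_real_mult)
  with root hq have "poly (map_poly complex_of_real r) z = 0" by simp
  then have "of_real u + z * of_real v = 0" by (simp add: r map_poly_pCons)
  then have "v = 0 \<and> u = 0" using Im by (auto simp: complex_eq_iff)
  then have "r = 0" by (simp add: r)
  then show ?thesis by (auto simp: r_def q_def dvd_eq_mod_eq_0)
qed

text \<open>The quadratic factor has a nonreal root if \<open>b \<noteq> 0\<close> and a double root if \<open>b = 0\<close>.\<close>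

lemma card_roots_eq_degree_or_quadratic_dvd:
  fixes p :: "real poly"
  assumes "p \<noteq> 0"
  shows "card {x. poly p x = 0} = degree p \<or> (\<exists>a b. [:- a, 1:] ^ 2 + [:b ^ 2:] dvd p)"
  using assms
proof (induction "degree p" arbitrary: p rule: less_induct)
  case less
  show ?case
  proof (cases "degree p = 0")
    case True
    then obtain c where "p = [:c:]" by (rule degree_eq_zeroE)
    with less.prems show ?thesis by simp
  next
    case False
    let ?P = "map_poly complex_of_real p"
    have "degree ?P \<noteq> 0" using False by (simp add: degree_map_poly)
    then have "\<not> constant (poly ?P)" by (simp add: constant_degree)
    then obtain z where z: "poly ?P z = 0" using fundamental_theorem_of_algebra by blast
    show ?thesis
    proof (cases "Im z = 0")
      case False
      \<comment> \<open>The quadratic alternative is met with \<open>a = Re z\<close> and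
        \<open>b = Im z\<close>, by completing the square.\<close>
      have "[:- Re z, 1:] ^ 2 + [:Im z ^ 2:] = [:(Re z)\<^sup>2 + (Im z)\<^sup>2, - 2 * Re z, 1:]"
        by (simp add: power2_eq_square)
      with quadratic_dvd_of_nonreal_root[OF z False] show ?thesis by metis
    next
      case True
      then have "z = of_real (Re z)" by (simp add: complex_eq_iff)
      then have "poly p (Re z) = 0" using z by (metis of_real_eq_0_iff poly_map_poly_of_real)
      then obtain q where q: "p = [:- Re z, 1:] * q" by (auto simp: poly_eq_0_iff_dvd elim: dvdE)
      with less.prems have q0: "q \<noteq> 0" by auto
      then have deg: "degree p = Suc (degree q)" by (simp add: q degree_mult_eq del: mult_pCons_left)
      consider "card {x. poly q x = 0} = degree q" | a b where "[:- a, 1:] ^ 2 + [:b ^ 2:] dvd q"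
        using less.hyps[of q] deg q0 by auto
      then show ?thesis
      proof cases
        case 1
        show ?thesis
        proof (cases "poly q (Re z) = 0")
          case True
          then have "[:- Re z, 1:] dvd q" by (simp add: poly_eq_0_iff_dvd)
          \<comment> \<open>A common root of both factors is a double root of \<open>p\<close>, the
            quadratic alternative with \<open>b = 0\<close>.\<close>
          then have "[:- Re z, 1:] ^ 2 + [:0 ^ 2:] dvd p"
            by (simp add: q power2_eq_square mult_dvd_mono del: mult_pCons_left mult_pCons_right)
          then show ?thesis by blast
        next
          case False
          \<comment> \<open>\<open>Re z\<close> is a new root, so the number of roots and the degree
            both grow by one.\<close>
          have "{x. poly p x = 0} = insert (Re z) {x. poly q x = 0}" by (auto simp: q)
          then show ?thesis using False 1 deg poly_roots_finite[OF q0] by simp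
        qed
      next
        case 2
        then show ?thesis unfolding q by (blast intro: dvd_mult)
      qed
    qed
  qed
qed

section \<open>Gauss quadrature\<close>

text \<open>Lagrange interpolation with unnormalised basis polynomials \<open>l x\<close>. Both
  sides have degree below \<open>card X\<close> and agree on \<open>X\<close>, hence
  coincide.\<close>

lemma polynomial_interpolation:
  fixes X :: "real set" and r :: "real poly"
  assumes fin: "finite X" and deg: "degree r < card X"
  defines "l \<equiv> \<lambda>x. \<Prod>y\<in>X - {x}. [:- y, 1:]"
  shows "r = (\<Sum>x\<in>X. Polynomial.smult (poly r x / poly (l x) x) (l x))" (is "r = ?s")
proof (rule poly_eqI_degree[where A = X])
  have l0: "poly (l x) x \<noteq> 0" for x
    using fin by (auto simp: l_def poly_prod)
  have l1: "poly (l x) y = 0" if "y \<in> X" "y \<noteq> x" for x y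
    using fin that by (auto simp: l_def poly_prod)
  fix x assume x: "x \<in> X"
  have "poly ?s x = (\<Sum>y\<in>X. poly r y / poly (l y) y * poly (l y) x)"
    by (simp add: poly_sum)
  also have "\<dots> = (\<Sum>y\<in>X. if y = x then poly r x else 0)"
    using x l0 l1 by (intro sum.cong) auto
  also have "\<dots> = poly r x" using fin x by simp
  finally show "poly r x = poly ?s x" by simp
next
  have "degree (l x) < card X" if "x \<in> X" for x
  proof -
    have "degree (l x) \<le> (\<Sum>y\<in>X - {x}. degree [:- y, 1:])"
      unfolding l_def using degree_prod_sum_le[of "X - {x}" "\<lambda>y. [:- y, 1:]"] fin by (simp add: o_def)
    also have "\<dots> = card X - 1" using fin that by simp
    \<comment> \<open>The degree hypothesis forces \<open>card X\<close> to be positive, so the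
      truncated subtraction is a genuine one.\<close>
    also have "\<dots> < card X" using deg by simp
    finally show ?thesis .
  qed
  then have "degree (Polynomial.smult (poly r x / poly (l x) x) (l x)) \<le> card X - 1"
    if "x \<in> X" for x
    using that degree_smult_le[of "poly r x / poly (l x) x" "l x"] by fastforce
  then have "degree ?s \<le> card X - 1" using fin by (intro degree_sum_le) auto
  then show "degree ?s < card X" using deg by simp
qed (use deg in simp)

section \<open>Positive definite Hankel matrices and their orthogonal polynomials\<close>

definition positive_functional :: "nat \<Rightarrow> (nat \<Rightarrow> real) \<Rightarrow> bool" where
  "positive_functional n m \<longleftrightarrow> (\<forall>p. p \<noteq> 0 \<longrightarrow> degree p < n \<longrightarrow> 0 < moment_functional m (p * p))"

definition hankel_mat :: "nat \<Rightarrow> (nat \<Rightarrow> real) \<Rightarrow> real mat" where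
  "hankel_mat n m = Matrix.mat n n (\<lambda>(i, j). m (i + j))"

lemma hankel_mat_carrier [simp]: "hankel_mat n m \<in> carrier_mat n n"
  by (simp add: hankel_mat_def)

lemma index_hankel_mat_mult_vec:
  assumes "v \<in> carrier_vec n" "i < n"
  shows "vec_index (hankel_mat n m *\<^sub>v v) i = (\<Sum>j<n. m (i + j) * vec_index v j)"
  using assms by (auto simp: hankel_mat_def scalar_prod_def atLeast0LessThan intro!: sum.cong)

text \<open>The quadratic form at the coefficient vector of \<open>p\<close> is the functional at
  \<open>p * p\<close>, and this vector is nonzero because the leading coefficient sits at index
  \<open>degree p < n\<close>. Positivity can then be combined with factorisations of
  polynomials.\<close>

lemma positive_functional_if_positive_definite:
  assumes "positive_definite n (hankel_mat n m)"
  shows "positive_functional n m"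
  unfolding positive_functional_def
proof (intro allI impI)
  fix p :: "real poly" assume p0: "p \<noteq> 0" and deg: "degree p < n"
  define v where "v = Matrix.vec n (coeff p)"
  have v: "v \<in> carrier_vec n" by (simp add: v_def)
  have "vec_index v (degree p) \<noteq> vec_index (0\<^sub>v n) (degree p)"
    using p0 deg by (simp add: v_def)
  then have "v \<noteq> 0\<^sub>v n" by metis
  with assms v have "0 < scalar_prod v (hankel_mat n m *\<^sub>v v)"
    unfolding positive_definite_def by blast
  also have "\<dots> = (\<Sum>i<n. vec_index v i * vec_index (hankel_mat n m *\<^sub>v v) i)"
    by (simp add: scalar_prod_def hankel_mat_def atLeast0LessThan)
  also have "\<dots> = (\<Sum>i<n. \<Sum>j<n. coeff p i * coeff p j * m (i + j))"
    using v by (simp add: index_hankel_mat_mult_vec sum_distrib_left v_def algebra_simps)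
  also have "\<dots> = moment_functional m (p * p)"
    using deg by (simp add: moment_functional_mult)
  finally show "0 < moment_functional m (p * p)" .
qed

text \<open>A nonzero kernel vector would make the quadratic form vanish, so the determinant is
  nonzero.\<close>

lemma positive_definite_imp_right_inverse:
  assumes "positive_definite n M"
  obtains B where "B \<in> carrier_mat n n" "M * B = 1\<^sub>m n"
proof -
  have M: "M \<in> carrier_mat n n" using assms by (simp add: positive_definite_def)
  have "Determinant.det M \<noteq> 0"
  proof
    assume "Determinant.det M = 0"
    then obtain v where v: "v \<in> carrier_vec n" "v \<noteq> 0\<^sub>v n" "M *\<^sub>v v = 0\<^sub>v n"
      using det_0_iff_vec_prod_zero[OF M] by blast
    then have "0 < scalar_prod v (M *\<^sub>v v)" using assms unfolding positive_definite_def by blast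
    with v show False by simp
  qed
  from det_non_zero_imp_unit[OF M this, of "()"] that show ?thesis
    by (auto simp: Units_def ring_mat_def)
qed

text \<open>For a monic \<open>p\<close>, written as \<open>x ^ n\<close> minus lower terms with
  coefficient vector \<open>c\<close>, orthogonality to the monomials of degree below
  \<open>n\<close> is the linear system \<open>hankel_mat n m *\<^sub>v c = h\<close>, which is
  solvable since the matrix is invertible.\<close>

lemma ex_orthogonal_poly:
  assumes "positive_definite n (hankel_mat n m)"
  obtains p where "degree p = n" "p \<noteq> 0"
    "\<And>q. degree q < n \<Longrightarrow> moment_functional m (p * q) = 0"
proof -
  obtain B where B: "B \<in> carrier_mat n n" "hankel_mat n m * B = 1\<^sub>m n"
    using positive_definite_imp_right_inverse[OF assms] .
  \<comment> \<open>The last entry of \<open>h\<close> is \<open>m (2 * n - 1)\<close>, which does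
    not occur in the Hankel matrix; whatever value \<open>m\<close> takes there is
    acceptable.\<close>
  define h where "h = Matrix.vec n (\<lambda>i. m (i + n))"
  define c where "c = B *\<^sub>v h"
  have h: "h \<in> carrier_vec n" by (simp add: h_def)
  have c: "c \<in> carrier_vec n" using B h by (auto simp: c_def)
  have "hankel_mat n m *\<^sub>v c = h"
    unfolding c_def using B h
    by (metis assoc_mult_mat_vec hankel_mat_carrier one_mult_mat_vec)
  then have c_eq: "(\<Sum>j<n. m (i + j) * vec_index c j) = m (i + n)" if "i < n" for i
    using index_hankel_mat_mult_vec[OF c that] that by (metis h_def index_vec)
  define s where "s = (\<Sum>j<n. monom (vec_index c j) j)"
  define p where "p = monom 1 n - s"
  have coeff_s: "coeff s n = 0" by (auto simp: s_def coeff_sum)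
  have "degree s \<le> n" unfolding s_def
    by (intro degree_sum_le) (auto intro: order_trans[OF degree_monom_le])
  then have "degree p \<le> n" unfolding p_def by (intro degree_diff_le) (auto simp: degree_monom_le)
  moreover have lc: "coeff p n = 1" by (simp add: p_def coeff_s)
  ultimately have deg: "degree p = n" by (simp add: le_antisym le_degree)
  have mon: "moment_functional m (p * monom u i) = 0" if "i < n" for u i
  proof -
    have "p * monom u i = monom u (n + i) + Polynomial.smult (- 1) (\<Sum>j<n. monom (vec_index c j * u) (j + i))"
      by (simp add: p_def s_def left_diff_distrib mult_monom sum_distrib_right)
    then have "moment_functional m (p * monom u i) =
        u * m (n + i) - (\<Sum>j<n. vec_index c j * u * m (j + i))"
      by (simp only: moment_functional_add moment_functional_smult moment_functional_sum
          moment_functional_monom)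
    also have "(\<Sum>j<n. vec_index c j * u * m (j + i)) = u * (\<Sum>j<n. m (i + j) * vec_index c j)"
      by (simp add: sum_distrib_left algebra_simps)
    finally show ?thesis using c_eq[OF that] by (simp add: add.commute)
  qed
  have "moment_functional m (p * q) = 0" if "degree q < n" for q
    by (subst poly_eq_sum_monoms_lessThan[OF that])
      (simp add: sum_distrib_left moment_functional_sum mon)
  moreover have "p \<noteq> 0" using lc by auto
  ultimately show ?thesis using deg that by blast
qed

text \<open>If \<open>p = ((x - a)\<^sup>2 + b\<^sup>2) q\<close>, then the functional is positive on
  \<open>p q = ((x - a) q)\<^sup>2 + (b q)\<^sup>2\<close>.\<close>

lemma card_roots_orthogonal_poly:
  assumes pos: "positive_functional n m" and deg: "degree p = n" and p0: "p \<noteq> 0"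
    and orth: "\<And>q. degree q < n \<Longrightarrow> moment_functional m (p * q) = 0"
  shows "card {x. poly p x = 0} = n"
proof (rule ccontr)
  assume "card {x. poly p x = 0} \<noteq> n"
  then obtain a b where "[:- a, 1:] ^ 2 + [:b ^ 2:] dvd p"
    using card_roots_eq_degree_or_quadratic_dvd[OF p0] deg by blast
  then obtain q where q: "p = ([:- a, 1:] ^ 2 + [:b ^ 2:]) * q" by (elim dvdE)
  then have q0: "q \<noteq> 0" using p0 by auto
  have e: "[:- a, 1:] ^ 2 + [:b ^ 2:] = [:a ^ 2 + b ^ 2, - 2 * a, 1:]"
    by (simp add: power2_eq_square)
  have "degree p = 2 + degree q"
    unfolding q e by (subst degree_mult_eq) (use q0 in auto)
  then have dq: "degree q + 2 = n" using deg by simp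
  \<comment> \<open>\<open>t\<close> has degree \<open>n - 1\<close>, the largest degree for which
    positivity on squares is assumed.\<close>
  define t where "t = [:- a, 1:] * q"
  have dt: "degree t = degree q + 1"
    unfolding t_def by (subst degree_mult_eq) (use q0 in auto)
  then have "t \<noteq> 0" by auto
  then have t_pos: "0 < moment_functional m (t * t)"
    using pos dt dq by (simp add: positive_functional_def)
  have q_pos: "0 < moment_functional m (q * q)"
    using pos q0 dq by (simp add: positive_functional_def)
  have "[:b ^ 2:] * q = Polynomial.smult (b ^ 2) q" by simp
  then have "p * q = t * t + Polynomial.smult (b ^ 2) (q * q)"
    unfolding q t_def
    by (simp add: power2_eq_square distrib_right mult.assoc mult.left_commute
        del: mult_pCons_left mult_pCons_right)
  then have "moment_functional m (p * q) =
      moment_functional m (t * t) + b ^ 2 * moment_functional m (q * q)"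
    by (simp add: moment_functional_add moment_functional_smult)
  \<comment> \<open>\<open>b\<close> may be \<open>0\<close>, so strictness comes from the square of
    \<open>t\<close>.\<close>
  also have "\<dots> > 0" using t_pos q_pos by (simp add: add_pos_nonneg)
  finally show False using orth[of q] dq by simp
qed

text \<open>The nodes are the roots of the orthogonal polynomial \<open>p\<close>. Dividing by
  \<open>p\<close> leaves a quotient that orthogonality annihilates and a remainder that
  interpolation at the nodes reproduces. Exponents up to \<open>2 * n - 2\<close> are exactly those
  occurring in the Hankel matrix.\<close>

lemma gauss_quadrature:
  assumes pd: "positive_definite n (hankel_mat n m)" and n: "0 < n"
  obtains X w where "finite X" "\<And>x. x \<in> X \<Longrightarrow> 0 < w x"
    "\<And>k. k \<le> 2 * n - 2 \<Longrightarrow> m k = (\<Sum>x\<in>X. w x * x ^ k)"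
proof -
  have pos: "positive_functional n m" by (rule positive_functional_if_positive_definite[OF pd])
  obtain p where p: "degree p = n" "p \<noteq> 0"
    and orth: "\<And>q. degree q < n \<Longrightarrow> moment_functional m (p * q) = 0"
    using ex_orthogonal_poly[OF pd] by blast
  define X where "X = {x. poly p x = 0}"
  have fin: "finite X" unfolding X_def by (rule poly_roots_finite[OF p(2)])
  have card: "card X = n" unfolding X_def by (rule card_roots_orthogonal_poly[OF pos p orth])
  define l where "l = (\<lambda>x. \<Prod>y\<in>X - {x}. [:- y, 1:])"
  \<comment> \<open>The weight is the functional at the normalised Lagrange polynomial of the
    node.\<close>
  define w where "w x = moment_functional m (l x) / poly (l x) x" for x
  have quad: "moment_functional m q = (\<Sum>x\<in>X. w x * poly q x)" if dq: "degree q \<le> 2 * n - 2" for q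
  proof -
    define r where "r = q mod p"
    have dr: "degree r < n" using degree_mod_less[OF p(2), of q] p(1) n by (auto simp: r_def)
    have qr: "q = p * (q div p) + r" by (simp add: r_def)
    \<comment> \<open>This bound on the quotient is what makes \<open>orth\<close> applicable to
      \<open>p * (q div p)\<close>.\<close>
    have "degree (q div p) < n"
    proof (cases "q div p = 0")
      case False
      have "n + degree (q div p) = degree (q - r)"
        using False p by (simp add: r_def minus_mod_eq_mult_div degree_mult_eq)
      also have "\<dots> \<le> 2 * n - 2" using dq dr by (intro degree_diff_le) auto
      finally show ?thesis using n by linarith
    qed (use n in simp)
    then have "moment_functional m q = moment_functional m r"
      by (subst qr) (simp add: moment_functional_add orth)
    also have "r = (\<Sum>x\<in>X. Polynomial.smult (poly r x / poly (l x) x) (l x))"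
      unfolding l_def using polynomial_interpolation[OF fin, of r] dr card by simp
    also have "moment_functional m \<dots> = (\<Sum>x\<in>X. w x * poly r x)"
      by (simp add: moment_functional_sum moment_functional_smult w_def field_simps)
    also have "\<dots> = (\<Sum>x\<in>X. w x * poly q x)"
    proof (intro sum.cong refl)
      \<comment> \<open>At a root of \<open>p\<close> the polynomial \<open>q\<close> and its
        remainder \<open>r\<close> take the same value.\<close>
      fix x assume "x \<in> X"
      then show "w x * poly r x = w x * poly q x"
        using arg_cong[OF qr, of "\<lambda>s. poly s x"] by (simp add: X_def)
    qed
    finally show ?thesis .
  qed
  \<comment> \<open>Apply the quadrature to the square of \<open>l x\<close>: it vanishes at all
    other nodes, leaving \<open>w x\<close> times a positive square, while the functional is
    positive on it.\<close>
  have "0 < w x" if x: "x \<in> X" for x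
  proof -
    have lx: "poly (l x) x \<noteq> 0" using fin by (auto simp: l_def poly_prod)
    then have l0: "l x \<noteq> 0" by auto
    have "degree (l x) \<le> (\<Sum>y\<in>X - {x}. degree [:- y, 1:])"
      unfolding l_def using degree_prod_sum_le[of "X - {x}" "\<lambda>y. [:- y, 1:]"] fin by (simp add: o_def)
    then have dl: "degree (l x) \<le> n - 1" using fin x card by simp
    then have "0 < moment_functional m (l x * l x)"
      using pos l0 n by (simp add: positive_functional_def)
    also have "\<dots> = (\<Sum>y\<in>X. w y * poly (l x * l x) y)"
      using dl degree_mult_le[of "l x" "l x"] by (intro quad) linarith
    also have "\<dots> = (\<Sum>y\<in>X. if y = x then w x * (poly (l x) x)\<^sup>2 else 0)"
      using fin by (intro sum.cong) (auto simp: l_def poly_prod power2_eq_square)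
    also have "\<dots> = w x * (poly (l x) x)\<^sup>2" using fin x by simp
    finally show ?thesis using lx by (simp add: zero_less_mult_iff)
  qed
  moreover have "m k = (\<Sum>x\<in>X. w x * x ^ k)" if "k \<le> 2 * n - 2" for k
    using quad[of "monom 1 k"] that by (simp add: moment_functional_monom degree_monom_eq poly_monom)
  ultimately show ?thesis using fin that by blast
qed

section \<open>The moment cone consists of the positive definite Hankel matrices\<close>

text \<open>A point measure on \<open>X\<close> lives on the power set of \<open>X\<close>; its
  image under the identity map into \<open>borel\<close> has the required sigma-algebra and the same
  finite sums as integrals.\<close>

lemma ex_finitely_supported_measure:
  fixes X :: "real set"
  assumes fin: "finite X" and w: "\<And>x. x \<in> X \<Longrightarrow> 0 \<le> w x"
  obtains \<rho> :: "real measure" where "sets \<rho> = sets borel" "finite_measure \<rho>"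
    "\<And>f :: real \<Rightarrow> real. f \<in> borel_measurable borel \<Longrightarrow> integrable \<rho> f"
    "\<And>f :: real \<Rightarrow> real. f \<in> borel_measurable borel \<Longrightarrow> integral\<^sup>L \<rho> f = (\<Sum>x\<in>X. w x * f x)"
proof -
  define \<mu> where "\<mu> = point_measure X (\<lambda>x. ennreal (w x))"
  have id: "(\<lambda>x. x) \<in> measurable \<mu> borel" using fin by (simp add: \<mu>_def)
  have fin_\<mu>: "finite_measure \<mu>"
    unfolding \<mu>_def using fin
    by (intro finite_measureI) (simp add: space_point_measure emeasure_point_measure_finite)
  have "sets (distr \<mu> borel (\<lambda>x. x)) = sets borel" by simp
  moreover have "finite_measure (distr \<mu> borel (\<lambda>x. x))"
    using fin_\<mu> id by (rule finite_measure.finite_measure_distr)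
  moreover have "integrable (distr \<mu> borel (\<lambda>x. x)) f" if "f \<in> borel_measurable borel" for f :: "real \<Rightarrow> real"
    using id that fin by (simp add: integrable_distr_eq \<mu>_def integrable_point_measure_finite)
  moreover have "integral\<^sup>L (distr \<mu> borel (\<lambda>x. x)) f = (\<Sum>x\<in>X. w x * f x)"
    if "f \<in> borel_measurable borel" for f :: "real \<Rightarrow> real"
    using id that fin w by (simp add: integral_distr \<mu>_def lebesgue_integral_point_measure_finite)
  ultimately show ?thesis by (rule that)
qed

lemma index_outer_prod_f_P:
  assumes "i < n" "j < n"
  shows "outer_prod (f_P n x) (f_P n x) $$ (i, j) = x ^ (i + j)"
  using assms by (simp add: outer_prod_def f_P_def power_add)

text \<open>A representing measure yields a Hankel matrix through its power moments; conversely,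
  Gauss quadrature supplies an atomic representing measure.\<close>

lemma moment_cone_iff_hankel:
  assumes n: "0 < n"
  shows "M \<in> moment_cone n \<longleftrightarrow> positive_definite n M \<and> (\<exists>m. M = hankel_mat n m)"
proof
  assume "M \<in> moment_cone n"
  then obtain \<rho> where pd: "positive_definite n M"
    and M: "M = mat_integral n \<rho> (\<lambda>x. outer_prod (f_P n x) (f_P n x))"
    by (auto simp: moment_cone_def)
  have "M = hankel_mat n (\<lambda>k. integral\<^sup>L \<rho> (\<lambda>x. x ^ k))"
    unfolding M by (rule eq_matI) (auto simp: mat_integral_def hankel_mat_def index_outer_prod_f_P)
  with pd show "positive_definite n M \<and> (\<exists>m. M = hankel_mat n m)" by blast
next
  assume "positive_definite n M \<and> (\<exists>m. M = hankel_mat n m)"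
  then obtain m where pd: "positive_definite n M" and M: "M = hankel_mat n m" by blast
  obtain X w where fin: "finite X" and w: "\<And>x. x \<in> X \<Longrightarrow> 0 < w x"
    and m: "\<And>k. k \<le> 2 * n - 2 \<Longrightarrow> m k = (\<Sum>x\<in>X. w x * x ^ k)"
    using gauss_quadrature[of n m] pd M n by blast
  obtain \<rho> :: "real measure" where \<rho>: "sets \<rho> = sets borel" "finite_measure \<rho>"
    and int: "\<And>f :: real \<Rightarrow> real. f \<in> borel_measurable borel \<Longrightarrow> integrable \<rho> f"
    and eq: "\<And>f :: real \<Rightarrow> real. f \<in> borel_measurable borel \<Longrightarrow> integral\<^sup>L \<rho> f = (\<Sum>x\<in>X. w x * f x)"
    using ex_finitely_supported_measure[OF fin, of w] w less_imp_le by metis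
  have "mat_integrable n \<rho> (\<lambda>x. outer_prod (f_P n x) (f_P n x))"
    by (auto simp: mat_integrable_def index_outer_prod_f_P intro!: int)
  moreover have "M = mat_integral n \<rho> (\<lambda>x. outer_prod (f_P n x) (f_P n x))"
    unfolding M
    by (rule eq_matI) (auto simp: mat_integral_def hankel_mat_def index_outer_prod_f_P eq m)
  ultimately show "M \<in> moment_cone n" using pd \<rho> by (auto simp: moment_cone_def)
qed

section \<open>The Moebius matrices form a group\<close>

lemma moebius_mat_carrier [simp]: "moebius_mat n a b c d \<in> carrier_mat n n"
  by (simp add: moebius_mat_def)

lemma f_P_carrier [simp]: "f_P n x \<in> carrier_vec n"
  by (simp add: f_P_def)

text \<open>The difference of two corresponding rows is the coefficient list of a polynomial with
  infinitely many roots. Allowing any infinite \<open>S\<close> leaves room to avoid a pole.\<close>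

lemma eq_mat_if_mult_f_P_eq:
  assumes A: "A \<in> carrier_mat n n" and B: "B \<in> carrier_mat n n" and S: "infinite S"
    and eq: "\<And>x. x \<in> S \<Longrightarrow> A *\<^sub>v f_P n x = B *\<^sub>v f_P n x"
  shows "A = B"
proof (rule eq_matI)
  fix i j assume "i < dim_row B" "j < dim_col B"
  then have i: "i < n" and j: "j < n" using B by auto
  define p where "p = (\<Sum>k<n. monom (A $$ (i, k) - B $$ (i, k)) k)"
  have "poly p x = 0" if "x \<in> S" for x
    using arg_cong[OF eq[OF that], of "\<lambda>v. vec_index v i"]
    by (simp add: p_def poly_sum poly_monom left_diff_distrib sum_subtractf
        mult_mat_vec_f_P[OF A i] mult_mat_vec_f_P[OF B i])
  then have "infinite {x. poly p x = 0}" using S by (metis (mono_tags, lifting) finite_subset mem_Collect_eq subsetI)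
  then have "p = 0" using poly_roots_finite by blast
  then have "coeff p j = 0" by simp
  with j show "A $$ (i, j) = B $$ (i, j)"
    by (simp add: p_def coeff_sum if_distrib sum.delta cong: if_cong)
qed (use A B in auto)

text \<open>Composition of fractional linear maps, compared away from the pole of the inner one. The
  outer matrix is evaluated by the division-free \<open>moebius_mat_mult_f_P\<close>, so its own
  pole causes no trouble.\<close>

lemma moebius_mat_mult:
  assumes det: "a' * d' - b' * c' \<noteq> 0"
  shows "moebius_mat n a b c d * moebius_mat n a' b' c' d' =
    moebius_mat n (a * a' + b * c') (a * b' + b * d') (c * a' + d * c') (c * b' + d * d')"
    (is "?A * ?B = ?C")
proof (rule eq_mat_if_mult_f_P_eq)
  have "[:d', c':] \<noteq> 0" using det by auto
  then have "finite {x. poly [:d', c':] x = 0}" by (rule poly_roots_finite)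
  then have "infinite (- {x. poly [:d', c':] x = 0})"
    using infinite_UNIV_char_0[where 'a = real] by (metis finite_compl)
  then show "infinite {x. c' * x + d' \<noteq> 0}"
    by (simp add: Collect_neg_eq algebra_simps)
next
  fix x assume "x \<in> {x. c' * x + d' \<noteq> 0}"
  then have t0: "c' * x + d' \<noteq> 0" by simp
  define t where "t = c' * x + d'"
  define y where "y = (a' * x + b') / t"
  have ty: "t * (u * y + v) = u * (a' * x + b') + v * (c' * x + d')" for u v
    using t0 by (simp add: y_def t_def field_simps)
  have "(?A * ?B) *\<^sub>v f_P n x = ?A *\<^sub>v (?B *\<^sub>v f_P n x)"
    by (rule assoc_mult_mat_vec[where n\<^sub>1 = n and n\<^sub>2 = n and n\<^sub>3 = n]) simp_all
  also have "?B *\<^sub>v f_P n x = t ^ (n - 1) \<cdot>\<^sub>v f_P n y"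
    unfolding t_def y_def using moebius_mat_transforms_f_P[OF t0] by simp
  also have "?A *\<^sub>v \<dots> = t ^ (n - 1) \<cdot>\<^sub>v (?A *\<^sub>v f_P n y)"
    by (rule mult_mat_vec[where nr = n and nc = n]) simp_all
  also have "\<dots> = ?C *\<^sub>v f_P n x"
  proof (rule eq_vecI)
    fix i assume "i < dim_vec (?C *\<^sub>v f_P n x)"
    then have i: "i < n" by (simp add: moebius_mat_def)
    \<comment> \<open>Each row is homogeneous of degree \<open>n - 1\<close> in the two linear
      forms, so every form receives one factor \<open>t\<close>, which clears its
      denominator.\<close>
    then have "t ^ (n - 1) = t ^ i * t ^ (n - 1 - i)" by (simp flip: power_add)
    then have "t ^ (n - 1) * ((a * y + b) ^ i * (c * y + d) ^ (n - 1 - i)) =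
        (t * (a * y + b)) ^ i * (t * (c * y + d)) ^ (n - 1 - i)"
      by (simp add: power_mult_distrib)
    then show "vec_index (t ^ (n - 1) \<cdot>\<^sub>v (?A *\<^sub>v f_P n y)) i = vec_index (?C *\<^sub>v f_P n x) i"
      using i unfolding moebius_mat_mult_f_P ty by (simp add: algebra_simps)
  qed (simp add: moebius_mat_def)
  finally show "(?A * ?B) *\<^sub>v f_P n x = ?C *\<^sub>v f_P n x" .
qed (auto intro: mult_carrier_mat[of _ n n])

lemma moebius_mat_one: "moebius_mat n 1 0 0 1 = 1\<^sub>m n"
  by (rule eq_mat_if_mult_f_P_eq[of _ _ _ "UNIV :: real set"])
    (auto simp: infinite_UNIV_char_0 moebius_mat_mult_f_P, simp add: f_P_def)

lemma moebius_mats_carrier: "A \<in> moebius_mats n \<Longrightarrow> A \<in> carrier_mat n n"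
  by (auto simp: moebius_mats_def)

lemma one_in_moebius_mats: "1\<^sub>m n \<in> moebius_mats n"
  unfolding moebius_mats_def moebius_mat_one[symmetric]
  by (intro CollectI exI[of _ 1] exI[of _ 0]) auto

lemma mult_in_moebius_mats:
  assumes "A \<in> moebius_mats n" "B \<in> moebius_mats n"
  shows "A * B \<in> moebius_mats n"
proof -
  obtain a b c d a' b' c' d' where AB: "A = moebius_mat n a b c d" "B = moebius_mat n a' b' c' d'"
    and det: "a * d - b * c \<noteq> 0" "a' * d' - b' * c' \<noteq> 0"
    using assms by (auto simp: moebius_mats_def)
  have "(a * a' + b * c') * (c * b' + d * d') - (a * b' + b * d') * (c * a' + d * c') =
      (a * d - b * c) * (a' * d' - b' * c')"
    by (simp add: algebra_simps)
  also have "\<dots> \<noteq> 0" using det by simp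
  finally show ?thesis unfolding AB moebius_mat_mult[OF det(2)] moebius_mats_def by blast
qed

lemma ex_inverse_moebius_mats:
  assumes "A \<in> moebius_mats n"
  obtains B where "B \<in> moebius_mats n" "A * B = 1\<^sub>m n" "B * A = 1\<^sub>m n"
proof -
  obtain a b c d where A: "A = moebius_mat n a b c d" and det: "a * d - b * c \<noteq> 0"
    using assms by (auto simp: moebius_mats_def)
  define D where "D = a * d - b * c"
  have D: "D \<noteq> 0" using det by (simp add: D_def)
  \<comment> \<open>The parameters form the inverse of the 2 x 2 parameter matrix. The adjugate
    without division by \<open>D\<close> would only give the scalar matrix
    \<open>D ^ (n - 1)\<close>.\<close>
  define B where "B = moebius_mat n (d / D) (- b / D) (- c / D) (a / D)"
  have "(d / D) * (a / D) - (- b / D) * (- c / D) = (a * d - b * c) / (D * D)"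
    using D by (simp add: field_simps)
  then have det': "(d / D) * (a / D) - (- b / D) * (- c / D) \<noteq> 0" using D det by simp
  have e: "a * (d / D) + b * (- c / D) = 1" "a * (- b / D) + b * (a / D) = 0"
    "c * (d / D) + d * (- c / D) = 0" "c * (- b / D) + d * (a / D) = 1"
    "d / D * a + - b / D * c = 1" "d / D * b + - b / D * d = 0"
    "- c / D * a + a / D * c = 0" "- c / D * b + a / D * d = 1"
    using D by (simp_all add: field_simps) (simp_all add: D_def algebra_simps)
  have "A * B = 1\<^sub>m n"
    unfolding A B_def moebius_mat_mult[OF det'] e by (rule moebius_mat_one)
  moreover have "B * A = 1\<^sub>m n"
    unfolding A B_def moebius_mat_mult[OF det] e by (rule moebius_mat_one)
  moreover have "B \<in> moebius_mats n"
    unfolding B_def moebius_mats_def using det' by blast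
  ultimately show ?thesis using that by blast
qed

lemma group_moebius_group: "group (moebius_group n)"
proof (rule groupI)
  fix A assume "A \<in> carrier (moebius_group n)"
  then obtain B where "B \<in> moebius_mats n" "B * A = 1\<^sub>m n"
    by (auto simp: moebius_group_def elim: ex_inverse_moebius_mats)
  then show "\<exists>B\<in>carrier (moebius_group n). B \<otimes>\<^bsub>moebius_group n\<^esub> A = \<one>\<^bsub>moebius_group n\<^esub>"
    by (auto simp: moebius_group_def)
qed (auto simp: moebius_group_def mult_in_moebius_mats one_in_moebius_mats
  dest!: moebius_mats_carrier intro: assoc_mult_mat)

section \<open>The action on the moment cone\<close>

text \<open>The form of the new matrix at \<open>v\<close> is the form of \<open>M\<close> at
  \<open>u = transpose_mat A *\<^sub>v v\<close>. Since \<open>transpose_mat B\<close> maps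
  \<open>u\<close> back to \<open>v\<close>, a nonzero \<open>v\<close> gives a nonzero
  \<open>u\<close>.\<close>

lemma positive_definite_congruence:
  assumes pd: "positive_definite n M" and A: "A \<in> carrier_mat n n" and B: "B \<in> carrier_mat n n"
    and AB: "A * B = 1\<^sub>m n"
  shows "positive_definite n (A * M * transpose_mat A)"
proof -
  have M: "M \<in> carrier_mat n n" and sym: "transpose_mat M = M"
    using pd by (auto simp: positive_definite_def)
  have "transpose_mat (A * M * transpose_mat A) = A * transpose_mat (A * M)"
    using A M by (subst transpose_mult[where nr = n and n = n and nc = n]) auto
  also have "\<dots> = A * (M * transpose_mat A)"
    using A M by (subst transpose_mult[where nr = n and n = n and nc = n]) (auto simp: sym)
  also have "\<dots> = A * M * transpose_mat A"
    using A M by (subst assoc_mult_mat[where n\<^sub>1 = n and n\<^sub>2 = n and n\<^sub>3 = n and n\<^sub>4 = n]) auto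
  finally have sym': "transpose_mat (A * M * transpose_mat A) = A * M * transpose_mat A" .
  have "0 < scalar_prod v (A * M * transpose_mat A *\<^sub>v v)"
    if v: "v \<in> carrier_vec n" and v0: "v \<noteq> 0\<^sub>v n" for v
  proof -
    define u where "u = transpose_mat A *\<^sub>v v"
    have u: "u \<in> carrier_vec n" using A v by (auto simp: u_def)
    have "transpose_mat B *\<^sub>v u = (transpose_mat B * transpose_mat A) *\<^sub>v v"
      unfolding u_def using A B v by (intro assoc_mult_mat_vec[symmetric]) auto
    also have "transpose_mat B * transpose_mat A = 1\<^sub>m n"
      using transpose_mult[OF A B] AB by simp
    finally have "transpose_mat B *\<^sub>v u = v" using v by simp
    moreover have "transpose_mat B *\<^sub>v 0\<^sub>v n = 0\<^sub>v n" using B by auto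
    ultimately have "u \<noteq> 0\<^sub>v n" using v0 by metis
    then have "0 < scalar_prod u (M *\<^sub>v u)" using pd u by (auto simp: positive_definite_def)
    also have "\<dots> = scalar_prod v (A *\<^sub>v (M *\<^sub>v u))"
      unfolding u_def using A M v
      by (subst transpose_vec_mult_scalar[where nr = n and nc = n]) auto
    also have "A *\<^sub>v (M *\<^sub>v u) = A * M * transpose_mat A *\<^sub>v v"
      unfolding u_def using A M v
      by (simp add: assoc_mult_mat_vec[where n\<^sub>1 = n and n\<^sub>2 = n and n\<^sub>3 = n] mult_carrier_mat)
    finally show ?thesis .
  qed
  then show ?thesis using sym' A M by (auto simp: positive_definite_def)
qed

text \<open>Entry \<open>(i, j)\<close> of the product is the moment functional of
  \<open>(a x + b)\<^bsup>i + j\<^esup> (c x + d)\<^bsup>2 n - 2 - i - j\<^esup>\<close>.\<close>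

lemma hankel_mat_moebius_congruence:
  "\<exists>m'. moebius_mat n a b c d * hankel_mat n m * transpose_mat (moebius_mat n a b c d) =
     hankel_mat n m'"
proof
  let ?A = "moebius_mat n a b c d"
  let ?p = "\<lambda>i. [:b, a:] ^ i * [:d, c:] ^ (n - 1 - i)"
  let ?m' = "\<lambda>k. moment_functional m ([:b, a:] ^ k * [:d, c:] ^ (2 * n - 2 - k))"
  show "?A * hankel_mat n m * transpose_mat ?A = hankel_mat n ?m'"
  proof (rule eq_matI)
    fix i j assume "i < dim_row (hankel_mat n ?m')" "j < dim_col (hankel_mat n ?m')"
    then have i: "i < n" and j: "j < n" by (auto simp: hankel_mat_def)
    have deg: "degree (?p i) < n" if "i < n" for i
    proof -
      have "degree (?p i) \<le> degree ([:b, a:] ^ i) + degree ([:d, c:] ^ (n - 1 - i))"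
        by (rule degree_mult_le)
      also have "\<dots> \<le> 1 * i + 1 * (n - 1 - i)"
        by (intro add_mono order_trans[OF degree_power_le] mult_right_mono) auto
      finally show ?thesis using that by simp
    qed
    have "(?A * hankel_mat n m * transpose_mat ?A) $$ (i, j) =
        (\<Sum>l<n. (\<Sum>k<n. coeff (?p i) k * m (k + l)) * coeff (?p j) l)"
      using i j
      by (simp add: moebius_mat_def hankel_mat_def times_mat_def scalar_prod_def atLeast0LessThan)
    also have "\<dots> = (\<Sum>k<n. \<Sum>l<n. coeff (?p i) k * coeff (?p j) l * m (k + l))"
      by (subst sum.swap) (simp add: sum_distrib_right sum_distrib_left mult_ac)
    also have "\<dots> = moment_functional m (?p i * ?p j)"
      using moment_functional_mult[OF deg[OF i] deg[OF j]] by simp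
    also have "?p i * ?p j = [:b, a:] ^ (i + j) * [:d, c:] ^ ((n - 1 - i) + (n - 1 - j))"
      by (simp only: power_add mult_ac)
    \<comment> \<open>The truncated subtractions are exact because \<open>i, j < n\<close>; now only
      \<open>i + j\<close> enters.\<close>
    also have "(n - 1 - i) + (n - 1 - j) = 2 * n - 2 - (i + j)" using i j by simp
    finally show "(?A * hankel_mat n m * transpose_mat ?A) $$ (i, j) = hankel_mat n ?m' $$ (i, j)"
      using i j by (simp add: hankel_mat_def)
  qed (auto simp: moebius_mat_def hankel_mat_def)
qed

lemma moment_cone_carrier: "M \<in> moment_cone n \<Longrightarrow> M \<in> carrier_mat n n"
  by (simp add: moment_cone_def positive_definite_def)

text \<open>Both halves of the Hankel characterisation are preserved separately, so no measure has
  to be transported.\<close>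

lemma moebius_congruence_in_moment_cone:
  assumes n: "0 < n" and A: "A \<in> moebius_mats n" and M: "M \<in> moment_cone n"
  shows "A * M * transpose_mat A \<in> moment_cone n"
proof -
  obtain B where "B \<in> moebius_mats n" "A * B = 1\<^sub>m n" using ex_inverse_moebius_mats[OF A] .
  moreover have "positive_definite n M" using M by (simp add: moment_cone_def)
  ultimately have "positive_definite n (A * M * transpose_mat A)"
    using A by (intro positive_definite_congruence) (auto dest: moebius_mats_carrier)
  then show ?thesis
    using M A hankel_mat_moebius_congruence
    unfolding moment_cone_iff_hankel[OF n] by (auto simp: moebius_mats_def)
qed

lemma congruence_mult:
  fixes A B M :: "'a :: comm_semiring_1 mat"
  assumes "A \<in> carrier_mat n n" "B \<in> carrier_mat n n" "M \<in> carrier_mat n n"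
  shows "A * B * M * transpose_mat (A * B) = A * (B * M * transpose_mat B) * transpose_mat A"
  using assms
  by (simp add: transpose_mult[of A n n B n] assoc_mult_mat[where n\<^sub>1 = n and n\<^sub>2 = n and n\<^sub>3 = n and n\<^sub>4 = n]
      mult_carrier_mat[of _ n n _ n])

text \<open>Congruence by \<open>A\<close> undoes congruence by \<open>B\<close>; this gives
  surjectivity onto the cone and the inverse bijection of the action.\<close>

lemma congruence_inverse:
  fixes A B M :: "'a :: comm_semiring_1 mat"
  assumes "A \<in> carrier_mat n n" "B \<in> carrier_mat n n" "M \<in> carrier_mat n n" "A * B = 1\<^sub>m n"
  shows "A * (B * M * transpose_mat B) * transpose_mat A = M"
  using congruence_mult[OF assms(1-3)] assms by (simp del: assoc_mult_mat)

theorem theorem3p9: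
  fixes n :: nat
  assumes "n \<ge> 2"
  shows "(\<forall>A \<in> moebius_mats n. \<forall>M \<in> moment_cone n. A * M * transpose_mat A \<in> moment_cone n) \<and>
    (\<forall>A \<in> moebius_mats n. {A * M * transpose_mat A | M. M \<in> moment_cone n} = moment_cone n) \<and>
    group_action (moebius_group n) (moment_cone n)
      (\<lambda>A. \<lambda>M \<in> moment_cone n. A * M * transpose_mat A)"
proof (intro conjI)
  let ?E = "moment_cone n"
  let ?\<phi> = "\<lambda>A. \<lambda>M \<in> ?E. A * M * transpose_mat A"
  have n: "0 < n" using assms by simp
  note closed = moebius_congruence_in_moment_cone[OF n]
  note carr = moebius_mats_carrier moment_cone_carrier
  show "\<forall>A \<in> moebius_mats n. \<forall>M \<in> ?E. A * M * transpose_mat A \<in> ?E"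
    using closed by blast
  show "\<forall>A \<in> moebius_mats n. {A * M * transpose_mat A | M. M \<in> ?E} = ?E"
  proof (intro ballI equalityI subsetI)
    fix A M assume A: "A \<in> moebius_mats n" and M: "M \<in> ?E"
    obtain B where B: "B \<in> moebius_mats n" "A * B = 1\<^sub>m n" using ex_inverse_moebius_mats[OF A] .
    \<comment> \<open>The preimage of \<open>M\<close> is its congruence by the inverse of
      \<open>A\<close>, again in the cone by closure.\<close>
    have "M = A * (B * M * transpose_mat B) * transpose_mat A"
      using congruence_inverse A B M by (metis carr)
    then show "M \<in> {A * M * transpose_mat A | M. M \<in> ?E}" using closed[OF B(1) M] by blast
  qed (use closed in blast)
  \<comment> \<open>\<open>Bij ?E\<close> consists of extensional bijections, hence the restricted
    abstraction in \<open>?\<phi>\<close>.\<close>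
  have bij: "?\<phi> A \<in> Bij ?E" if A: "A \<in> moebius_mats n" for A
  proof -
    obtain B where B: "B \<in> moebius_mats n" "A * B = 1\<^sub>m n" "B * A = 1\<^sub>m n"
      using ex_inverse_moebius_mats[OF A] .
    have "bij_betw (?\<phi> A) ?E ?E"
    proof (rule bij_betwI[where g = "?\<phi> B"])
      show "?\<phi> A \<in> ?E \<rightarrow> ?E" "?\<phi> B \<in> ?E \<rightarrow> ?E" using closed A B(1) by auto
      show "?\<phi> B (?\<phi> A M) = M" "?\<phi> A (?\<phi> B M) = M" if "M \<in> ?E" for M
        using that closed[OF A that] closed[OF B(1) that] A B carr
          congruence_inverse[of A n B M] congruence_inverse[of B n A M] by auto
    qed
    then show ?thesis by (simp add: Bij_def)
  qed
  have "?\<phi> \<in> hom (moebius_group n) (BijGroup ?E)"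
  proof (rule homI)
    fix A B assume "A \<in> carrier (moebius_group n)" "B \<in> carrier (moebius_group n)"
    then have AB: "A \<in> moebius_mats n" "B \<in> moebius_mats n" by (auto simp: moebius_group_def)
    \<comment> \<open>Both sides are undefined off \<open>?E\<close>; on it, closure under
      \<open>B\<close> lets the outer restricted map unfold.\<close>
    have "?\<phi> (A * B) = compose ?E (?\<phi> A) (?\<phi> B)"
      using AB closed carr congruence_mult[of A n B] by (intro ext) (auto simp: compose_def)
    then show "?\<phi> (A \<otimes>\<^bsub>moebius_group n\<^esub> B) = ?\<phi> A \<otimes>\<^bsub>BijGroup ?E\<^esub> ?\<phi> B"
      using bij AB by (simp add: moebius_group_def BijGroup_def)
  qed (use bij in \<open>simp add: moebius_group_def BijGroup_def\<close>)
  then show "group_action (moebius_group n) ?E ?\<phi>"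
    by (simp add: group_action_def group_hom_def group_hom_axioms_def group_moebius_group
        group_BijGroup)
qed

end
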